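(* Let $H$ be a real Hilbert space and $\mu_F,\mu_G\in\mathbb{R}$. Let $F:H\to 2^H$ be maximal $\mu_F$-monotone and let $G:H\to H$ be $\mu_G$-monotone and Lipschitz continuous on $H$. Then $F+G$ is maximal $(\mu_F+\mu_G)$-monotone.
   Context: For $\mu\in\mathbb{R}$ (possibly negative), an operator $F:H\to 2^H$ is $\mu$-monotone if $\langle x-y,u-v\rangle\ge\mu\|x-y\|^2$ for all $x,y\in H$, $u\in F(x)$, $v\in F(y)$. A $\mu$-monotone operator is maximal $\mu$-monotone if there is no $\mu$-monotone operator whose graph strictly contains its graph, where the graph of $F$ is $\{(x,u)\in H\times H: u\in F(x)\}$. A single-valued $G:H\to H$ is regarded as the set-valued operator $x\mapsto\{G(x)\}$, and $(F+G)(x)=\{u+G(x):u\in F(x)\}$. *)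

theory Defs
  imports "HOL-Analysis.Analysis"
begin

definition op_graph :: "('a \<Rightarrow> 'a set) \<Rightarrow> ('a \<times> 'a) set" where
  "op_graph F = {(x, u). u \<in> F x}"

definition mu_monotone :: "real \<Rightarrow> ('a::real_inner \<Rightarrow> 'a set) \<Rightarrow> bool" where
  "mu_monotone \<mu> F \<longleftrightarrow>
     (\<forall>x y. \<forall>u\<in>F x. \<forall>v\<in>F y. inner (x - y) (u - v) \<ge> \<mu> * (norm (x - y))\<^sup>2)"

definition maximal_mu_monotone :: "real \<Rightarrow> ('a::real_inner \<Rightarrow> 'a set) \<Rightarrow> bool" where
  "maximal_mu_monotone \<mu> F \<longleftrightarrow>
     mu_monotone \<mu> F \<and> \<not> (\<exists>F'. mu_monotone \<mu> F' \<and> op_graph F \<subset> op_graph F')"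

definition single_valued_op :: "('a \<Rightarrow> 'a) \<Rightarrow> 'a \<Rightarrow> 'a set" where
  "single_valued_op G = (\<lambda>x. {G x})"

definition op_plus :: "('a::plus \<Rightarrow> 'a set) \<Rightarrow> ('a \<Rightarrow> 'a) \<Rightarrow> 'a \<Rightarrow> 'a set" where
  "op_plus F G = (\<lambda>x. {u + G x | u. u \<in> F x})"

end

theory Submission
  imports Defs
begin

text \<open>
  After shifting by multiples of the identity, everything rests on Minty's theorem: the resolvents of
  a maximal monotone operator on a Hilbert space are everywhere defined. If \<open>(x, w + G x)\<close>
  is monotonically related to \<open>F + G\<close>, solve \<open>y + c v = x + c w\<close> with \<open>v \<in> F y\<close> for
  a small \<open>c > 0\<close>; the Lipschitz bound forces \<open>y = x\<close>, hence \<open>w = v \<in> F x\<close>.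

  For Minty's theorem, let \<open>\<phi>(x,u) = sup {\<langle>x,v\<rangle> + \<langle>y,u\<rangle> - \<langle>y,v\<rangle> | (y,v) \<in> M}\<close> be the Fitzpatrick
  function of \<open>M\<close>. It dominates \<open>\<langle>x,u\<rangle>\<close> by maximality, so the strongly convex function
  \<open>\<phi> + \<parallel>\<cdot>\<parallel>\<^sup>2/2\<close> is bounded below and attains its minimum, at \<open>(x,u)\<close> say; strong convexity makes
  minimising sequences Cauchy, so no weak compactness is needed. The optimality condition says that
  \<open>(-u,-x)\<close> is monotonically related to \<open>M\<close>, hence lies in \<open>M\<close>, and then that \<open>u = -x\<close>.
\<close>

text \<open>The set \<open>C\<close> plays the role of the epigraph of a convex function \<open>\<phi>\<close>, which avoids infinite
  values; the conclusion says that \<open>-p\<close> is a subgradient of \<open>\<phi>\<close> at the minimiser \<open>p\<close> of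
  \<open>\<phi> + \<parallel>\<cdot>\<parallel>\<^sup>2/2\<close>.\<close>

lemma epigraph_minimiser:
  fixes C :: "('a::{real_inner,complete_space} \<times> real) set"
  assumes cl: "closed C" and cv: "convex C" and ne: "C \<noteq> {}"
    and bdd: "\<And>p t. (p, t) \<in> C \<Longrightarrow> b \<le> t + (norm p)\<^sup>2 / 2"
  obtains p t where "(p, t) \<in> C" "\<And>q s. (q, s) \<in> C \<Longrightarrow> t - inner p (q - p) \<le> s"
proof -
  define f where "f = (\<lambda>c::'a \<times> real. snd c + (norm (fst c))\<^sup>2 / 2)"
  define m where "m = Inf (f ` C)"
  have bb: "bdd_below (f ` C)"
    using bdd by (auto simp: f_def intro!: bdd_belowI[of _ b])
  have m_le: "m \<le> f c" if "c \<in> C" for c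
    unfolding m_def using that bb by (simp add: cInf_lower)
  have "\<exists>c\<in>C. f c < m + inverse (real (Suc n))" for n
    using cInf_lessD[of "f ` C" "m + inverse (real (Suc n))"] ne by (auto simp: m_def)
  then obtain c where cC: "\<And>n. c n \<in> C" and cm: "\<And>n. f (c n) < m + inverse (real (Suc n))"
    by metis
  have lim_inv: "(\<lambda>n. m + inverse (real (Suc n))) \<longlonglongrightarrow> m"
    using tendsto_add[OF tendsto_const LIMSEQ_inverse_real_of_nat, of m] by simp
  have flim: "(\<lambda>n. f (c n)) \<longlonglongrightarrow> m"
    by (rule tendsto_sandwich[OF _ _ tendsto_const lim_inv])
       (intro always_eventually allI m_le cC less_imp_le[OF cm])+
  \<comment> \<open>The midpoint of \<open>a\<close> and \<open>a'\<close> lies in \<open>C\<close>,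
    so \<open>f\<close> is at least \<open>m\<close> there, while the quadratic term lowers the
    average of the two values by an eighth of the squared distance.\<close>
  have mid: "(norm (fst a - fst a'))\<^sup>2 \<le> 4 * ((f a - m) + (f a' - m))"
    if "a \<in> C" "a' \<in> C" for a a'
  proof -
    have "(1/2) *\<^sub>R a + (1/2) *\<^sub>R a' \<in> C"
      using cv that by (intro convexD) auto
    moreover have "f ((1/2) *\<^sub>R a + (1/2) *\<^sub>R a')
        = (f a + f a') / 2 - (norm (fst a - fst a'))\<^sup>2 / 8"
      unfolding f_def
      by (simp add: power2_norm_eq_inner algebra_simps inner_commute) (simp add: field_simps)
    ultimately show ?thesis using m_le[of "(1/2) *\<^sub>R a + (1/2) *\<^sub>R a'"] by argo
  qed
  have "Cauchy (\<lambda>n. fst (c n))"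
  proof (rule CauchyI)
    fix e :: real assume "0 < e"
    then have "0 < e\<^sup>2 / 8" by simp
    then have "\<forall>\<^sub>F n in sequentially. f (c n) < m + e\<^sup>2 / 8"
      using order_tendstoD(2)[OF flim] by simp
    then obtain N where N: "\<And>n. n \<ge> N \<Longrightarrow> f (c n) < m + e\<^sup>2 / 8"
      by (auto simp: eventually_sequentially)
    have "norm (fst (c i) - fst (c j)) < e" if "i \<ge> N" "j \<ge> N" for i j
    proof (rule power2_less_imp_less)
      show "(norm (fst (c i) - fst (c j)))\<^sup>2 < e\<^sup>2"
        using mid[OF cC[of i] cC[of j]] N[OF that(1)] N[OF that(2)] by argo
    qed (use \<open>0 < e\<close> in simp)
    then show "\<exists>N. \<forall>i\<ge>N. \<forall>j\<ge>N. norm (fst (c i) - fst (c j)) < e" by blast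
  qed
  then obtain p where p: "(\<lambda>n. fst (c n)) \<longlonglongrightarrow> p"
    using Cauchy_convergent_iff convergent_def by blast
  \<comment> \<open>Chosen so that \<open>f (p, t) = m\<close>.\<close>
  define t where "t = m - (norm p)\<^sup>2 / 2"
  have "(\<lambda>n. f (c n) - (norm (fst (c n)))\<^sup>2 / 2) \<longlonglongrightarrow> t"
    unfolding t_def by (intro tendsto_intros flim p) auto
  then have "(\<lambda>n. snd (c n)) \<longlonglongrightarrow> t" by (simp add: f_def)
  with p have "(\<lambda>n. (fst (c n), snd (c n))) \<longlonglongrightarrow> (p, t)" by (rule tendsto_Pair)
  then have ptC: "(p, t) \<in> C"
    using closed_sequentially[OF cl, of c "(p, t)"] cC by simp
  have "t - inner p (q - p) \<le> s" if qs: "(q, s) \<in> C" for q s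
  proof -
    \<comment> \<open>Compare \<open>f\<close> at \<open>(p, t)\<close> with its value a fraction
      \<open>l\<close> along the segment to \<open>(q, s)\<close>, and divide by \<open>l\<close>;
      the quadratic remainder vanishes as \<open>l\<close> tends to 0.\<close>
    have step: "0 \<le> s - t + inner p (q - p) + l / 2 * (norm (q - p))\<^sup>2"
      if l: "0 < l" "l < 1" for l :: real
    proof -
      have "(1 - l) *\<^sub>R (p, t) + l *\<^sub>R (q, s) \<in> C"
        using cv ptC qs l by (intro convexD) auto
      from m_le[OF this]
      have "0 \<le> f ((1 - l) *\<^sub>R (p, t) + l *\<^sub>R (q, s)) - m" by simp
      also have "\<dots> = l * (s - t + inner p (q - p) + l / 2 * (norm (q - p))\<^sup>2)"
        unfolding f_def t_def power2_norm_eq_inner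
        by (simp add: algebra_simps inner_commute) (simp add: field_simps)
      finally show ?thesis using l by (simp add: zero_le_mult_iff)
    qed
    have "((\<lambda>l. s - t + inner p (q - p) + l / 2 * (norm (q - p))\<^sup>2) \<longlongrightarrow>
        s - t + inner p (q - p) + 0 / 2 * (norm (q - p))\<^sup>2) (at_right 0)"
      by (intro tendsto_intros) auto
    then have "0 \<le> s - t + inner p (q - p) + 0 / 2 * (norm (q - p))\<^sup>2"
      by (rule tendsto_lowerbound)
         (use step in \<open>auto simp: eventually_at_right_field intro!: exI[of _ 1]\<close>)
    then show ?thesis by simp
  qed
  with ptC show thesis by (rule that)
qed

text \<open>This is surjectivity of identity plus \<open>M\<close> at the single value 0; other
  values and step sizes follow by translating and scaling \<open>M\<close>.\<close>

theorem minty_zero: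
  fixes M :: "('a::{real_inner,complete_space} \<times> 'a) set"
  assumes mono: "\<And>x u y v. (x, u) \<in> M \<Longrightarrow> (y, v) \<in> M \<Longrightarrow> 0 \<le> inner (x - y) (u - v)"
    and maxi: "\<And>x u. (\<And>y v. (y, v) \<in> M \<Longrightarrow> 0 \<le> inner (x - y) (u - v)) \<Longrightarrow> (x, u) \<in> M"
  shows "\<exists>x. (x, - x) \<in> M"
proof -
  \<comment> \<open>The epigraph of the Fitzpatrick function, with one closed half-space for each
    point of \<open>M\<close>.\<close>
  define C where "C = (\<Inter>(y, v)\<in>M. {c. inner ((v, y), -1::real) c \<le> inner y v})"
  have C_iff: "((x, u), t) \<in> C \<longleftrightarrow>
      (\<forall>(y, v)\<in>M. inner x v + inner y u - inner y v \<le> t)" for x u t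
    by (fastforce simp: C_def inner_commute algebra_simps)
  have cl: "closed C"
    unfolding C_def by (intro closed_INT) (auto intro: closed_halfspace_le)
  have cv: "convex C"
    unfolding C_def by (intro convex_INT) (auto intro: convex_halfspace_le)
  have M_C: "((y, v), inner y v) \<in> C" if "(y, v) \<in> M" for y v
    using mono[OF that] by (fastforce simp: C_iff algebra_simps inner_commute)
  have "M \<noteq> {}" using maxi by blast
  then have ne: "C \<noteq> {}" using M_C by fastforce
  \<comment> \<open>If this failed, \<open>(x, u)\<close> would be monotonically related to
    \<open>M\<close>, hence in \<open>M\<close>, and testing the strict inequality at
    \<open>(x, u)\<close> itself is absurd.\<close>
  have dom: "inner x u \<le> t" if C: "((x, u), t) \<in> C" for x u t
  proof (rule ccontr)
    assume "\<not> inner x u \<le> t"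
    then have lt: "inner x v + inner y u - inner y v < inner x u" if "(y, v) \<in> M" for y v
      using C that unfolding C_iff by fastforce
    then have "(x, u) \<in> M"
      by (intro maxi) (smt (verit) inner_diff_left inner_diff_right)
    from lt[OF this] show False by simp
  qed
  have bdd: "0 \<le> t + (norm p)\<^sup>2 / 2" if "(p, t) \<in> C" for p t
  proof -
    obtain x u where p: "p = (x, u)" by (cases p)
    have "0 \<le> (norm (x + u))\<^sup>2 / 2" by simp
    also have "\<dots> = inner x u + (norm p)\<^sup>2 / 2"
      by (simp add: p power2_norm_eq_inner algebra_simps inner_commute)
    finally show ?thesis using dom that p by fastforce
  qed
  obtain p t where pt: "(p, t) \<in> C"
    and opt: "\<And>q s. (q, s) \<in> C \<Longrightarrow> t - inner p (q - p) \<le> s"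
    using epigraph_minimiser[OF cl cv ne bdd] by metis
  obtain x u where p: "p = (x, u)" by (cases p)
  \<comment> \<open>Test optimality at the epigraph point over \<open>(y, v)\<close>, whose height
    is \<open>inner y v\<close>, and bound \<open>t\<close> below by
    \<open>inner x u\<close>.\<close>
  have key: "(norm (x + u))\<^sup>2 \<le> inner (- u - y) (- x - v)" if "(y, v) \<in> M" for y v
  proof -
    have "t - inner p ((y, v) - p) \<le> inner y v" by (rule opt[OF M_C[OF that]])
    moreover have "inner x u \<le> t" using dom pt p by simp
    ultimately show ?thesis
      by (simp add: p power2_norm_eq_inner algebra_simps inner_commute)
  qed
  have "(- u, - x) \<in> M"
    by (rule maxi) (meson key order_trans zero_le_power2)
  from key[OF this] have "u = - x" by (simp add: add_eq_0_iff)
  with \<open>(- u, - x) \<in> M\<close> show ?thesis by auto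
qed

text \<open>Adjoining one related pair to the graph preserves \<mu>-monotonicity, so maximality need
  only be tested pair by pair.\<close>

lemma maximal_mu_monotone_iff:
  "maximal_mu_monotone \<mu> F \<longleftrightarrow> mu_monotone \<mu> F \<and>
    (\<forall>x u. (\<forall>y. \<forall>v\<in>F y. \<mu> * (norm (x - y))\<^sup>2 \<le> inner (x - y) (u - v)) \<longrightarrow> u \<in> F x)"
  (is "_ \<longleftrightarrow> _ \<and> ?R")
proof (intro iffI conjI)
  assume max: "maximal_mu_monotone \<mu> F"
  then show mono: "mu_monotone \<mu> F" by (simp add: maximal_mu_monotone_def)
  show ?R
  proof (intro allI impI, rule ccontr)
    fix x u
    assume rel: "\<forall>y. \<forall>v\<in>F y. \<mu> * (norm (x - y))\<^sup>2 \<le> inner (x - y) (u - v)" and "u \<notin> F x"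
    define F' where "F' = F(x := insert u (F x))"
    have rel': "\<mu> * (norm (y - x))\<^sup>2 \<le> inner (y - x) (v - u)" if "v \<in> F y" for y v
    proof -
      have "inner (y - x) (v - u) = inner (x - y) (u - v)"
        by (simp add: algebra_simps)
      then show ?thesis using rel that by (simp add: norm_minus_commute[of y x])
    qed
    have "mu_monotone \<mu> F'"
      using mono rel rel' unfolding mu_monotone_def F'_def by auto
    moreover have "op_graph F \<subset> op_graph F'"
      using \<open>u \<notin> F x\<close> unfolding F'_def op_graph_def by (auto split: if_splits)
    ultimately show False using max unfolding maximal_mu_monotone_def by blast
  qed
next
  assume *: "mu_monotone \<mu> F \<and> ?R"
  have "u \<in> F x" if "mu_monotone \<mu> F'" "op_graph F \<subset> op_graph F'" "u \<in> F' x" for F' x u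
    using * that unfolding mu_monotone_def op_graph_def by blast
  with * show "maximal_mu_monotone \<mu> F"
    unfolding maximal_mu_monotone_def op_graph_def by blast
qed

text \<open>Subtracting \<mu> times the identity makes \<open>F\<close> maximal monotone; scaling by
  \<open>c\<close> and translating by \<open>z\<close> then reduces the claim to
  \<open>minty_zero\<close>.\<close>

lemma resolvent_surjective:
  fixes F :: "'a::{real_inner,complete_space} \<Rightarrow> 'a set"
  assumes max: "maximal_mu_monotone \<mu> F" and c: "0 < c"
  shows "\<exists>y. \<exists>v\<in>F y. y + c *\<^sub>R (v - \<mu> *\<^sub>R y) = z"
proof -
  define M where "M = {(y, c *\<^sub>R (v - \<mu> *\<^sub>R y) - z) | y v. v \<in> F y}"
  have shift: "inner (x - y) ((c *\<^sub>R (u - \<mu> *\<^sub>R x) - z) - (c *\<^sub>R (v - \<mu> *\<^sub>R y) - z))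
      = c * (inner (x - y) (u - v) - \<mu> * (norm (x - y))\<^sup>2)" for x y u v
    by (simp add: power2_norm_eq_inner algebra_simps inner_commute)
  have "\<exists>x. (x, - x) \<in> M"
  proof (rule minty_zero)
    fix x u y v assume "(x, u) \<in> M" "(y, v) \<in> M"
    then obtain u' v' where "u' \<in> F x" "v' \<in> F y"
      and uv: "u = c *\<^sub>R (u' - \<mu> *\<^sub>R x) - z" "v = c *\<^sub>R (v' - \<mu> *\<^sub>R y) - z"
      unfolding M_def by blast
    then have "\<mu> * (norm (x - y))\<^sup>2 \<le> inner (x - y) (u' - v')"
      using max unfolding maximal_mu_monotone_def mu_monotone_def by blast
    then show "0 \<le> inner (x - y) (u - v)"
      unfolding uv shift using c by simp
  next
    fix x u assume rel: "\<And>y v. (y, v) \<in> M \<Longrightarrow> 0 \<le> inner (x - y) (u - v)"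
    define w where "w = inverse c *\<^sub>R (u + z) + \<mu> *\<^sub>R x"
    have u: "u = c *\<^sub>R (w - \<mu> *\<^sub>R x) - z" using c by (simp add: w_def)
    have "\<mu> * (norm (x - y))\<^sup>2 \<le> inner (x - y) (w - v)" if "v \<in> F y" for y v
    proof -
      have "0 \<le> inner (x - y) (u - (c *\<^sub>R (v - \<mu> *\<^sub>R y) - z))"
        by (rule rel) (use that in \<open>auto simp: M_def\<close>)
      then show ?thesis unfolding u shift using c by (simp add: zero_le_mult_iff)
    qed
    then have "w \<in> F x" using max unfolding maximal_mu_monotone_iff by blast
    then show "(x, u) \<in> M" unfolding u M_def by blast
  qed
  then obtain y v where "v \<in> F y" "c *\<^sub>R (v - \<mu> *\<^sub>R y) - z = - y"
    by (auto simp: M_def)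
  then have "y + c *\<^sub>R (v - \<mu> *\<^sub>R y) = z" by (simp add: algebra_simps)
  with \<open>v \<in> F y\<close> show ?thesis by blast
qed

theorem lemma2p6:
  fixes F :: "'h::{real_inner,complete_space} \<Rightarrow> 'h set"
    and G :: "'h \<Rightarrow> 'h"
    and \<mu>F \<mu>G :: real
  assumes "maximal_mu_monotone \<mu>F F"
    and "mu_monotone \<mu>G (single_valued_op G)"
    and "\<exists>L. L-lipschitz_on UNIV G"
  shows "maximal_mu_monotone (\<mu>F + \<mu>G) (op_plus F G)"
  unfolding maximal_mu_monotone_iff
proof (intro conjI allI impI)
  have "(\<mu>F + \<mu>G) * (norm (x - y))\<^sup>2 \<le> inner (x - y) ((u + G x) - (v + G y))"
    if "u \<in> F x" "v \<in> F y" for x y u v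
  proof -
    have "\<mu>F * (norm (x - y))\<^sup>2 \<le> inner (x - y) (u - v)"
      using assms(1) that unfolding maximal_mu_monotone_def mu_monotone_def by blast
    moreover have "\<mu>G * (norm (x - y))\<^sup>2 \<le> inner (x - y) (G x - G y)"
      using assms(2) unfolding mu_monotone_def single_valued_op_def by blast
    ultimately show ?thesis by (simp add: algebra_simps)
  qed
  then show "mu_monotone (\<mu>F + \<mu>G) (op_plus F G)"
    unfolding mu_monotone_def op_plus_def by blast
next
  fix x u
  assume rel: "\<forall>y. \<forall>v\<in>op_plus F G y.
    (\<mu>F + \<mu>G) * (norm (x - y))\<^sup>2 \<le> inner (x - y) (u - v)"
  obtain L where L: "L-lipschitz_on UNIV G" using assms(3) by blast
  \<comment> \<open>Large enough that \<open>K + \<mu>G - L\<close> is positive; the step size is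
    \<open>inverse K\<close>.\<close>
  define K where "K = \<bar>L\<bar> + \<bar>\<mu>G\<bar> + 1"
  define w where "w = u - G x"
  have K: "0 < K" by (simp add: K_def)
  \<comment> \<open>The right-hand side is the one for which \<open>(x, w)\<close> itself would be a
    solution; the estimates below force \<open>y = x\<close>.\<close>
  obtain y v where v: "v \<in> F y"
    and eq: "y + inverse K *\<^sub>R (v - \<mu>F *\<^sub>R y) = x + inverse K *\<^sub>R (w - \<mu>F *\<^sub>R x)"
    using resolvent_surjective[OF assms(1), of "inverse K"] K by (metis positive_imp_inverse_positive)
  have "K *\<^sub>R (y + inverse K *\<^sub>R (v - \<mu>F *\<^sub>R y)) = K *\<^sub>R (x + inverse K *\<^sub>R (w - \<mu>F *\<^sub>R x))"
    by (simp only: eq)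
  then have "K *\<^sub>R y + (v - \<mu>F *\<^sub>R y) = K *\<^sub>R x + (w - \<mu>F *\<^sub>R x)"
    using K by (simp add: scaleR_add_right)
  then have wv: "w - v = \<mu>F *\<^sub>R (x - y) - K *\<^sub>R (x - y)"
    by (simp add: algebra_simps)
  have "v + G y \<in> op_plus F G y" using v by (auto simp: op_plus_def)
  then have "(\<mu>F + \<mu>G) * (norm (x - y))\<^sup>2 \<le> inner (x - y) (u - (v + G y))"
    using rel by blast
  also have "u - (v + G y) = (w - v) + (G x - G y)" by (simp add: w_def)
  also have "inner (x - y) \<dots> = (\<mu>F - K) * (norm (x - y))\<^sup>2 + inner (x - y) (G x - G y)"
    unfolding wv by (simp add: power2_norm_eq_inner inner_add_right inner_diff_right left_diff_distrib)
  also have "inner (x - y) (G x - G y) \<le> L * (norm (x - y))\<^sup>2"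
  proof -
    have "inner (x - y) (G x - G y) \<le> norm (x - y) * norm (G x - G y)"
      by (rule norm_cauchy_schwarz)
    also have "\<dots> \<le> norm (x - y) * (L * norm (x - y))"
      using lipschitz_onD[OF L, of x y] by (intro mult_left_mono) (auto simp: dist_norm)
    finally show ?thesis by (simp add: power2_eq_square mult_ac)
  qed
  finally have "(K + \<mu>G - L) * (norm (x - y))\<^sup>2 \<le> 0" by (simp add: algebra_simps)
  moreover have "0 < K + \<mu>G - L" by (simp add: K_def)
  ultimately have "x = y" by (simp add: mult_le_0_iff)
  with wv v have "w \<in> F x" by simp
  then show "u \<in> op_plus F G x" by (auto simp: op_plus_def w_def intro!: exI[of _ "u - G x"])
qed

end
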